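(* (i) Let $(X,d)$ be a metric space and let $\mathcal{I}$ and $\mathcal{K}$ be two ideals on a set $S$ with $\mathcal{K}\subseteq\mathcal{I}$. If $f\colon S\to X$ is $\mathcal{I}^{\mathcal{K}}$-divergent, then it is also $\mathcal{I}$-divergent. (ii) Let $(X,d)$ be a metric space such that $d$ is not bounded. Let $\mathcal{I}$ and $\mathcal{K}$ be ideals on a set $S$ such that there is at least one $\mathcal{K}$-divergent function from $S$ to $X$. If $\mathcal{I}^{\mathcal{K}}$-divergence implies $\mathcal{I}$-divergence for every function $f\colon S\to X$, then $\mathcal{K}\subseteq\mathcal{I}$.
   Context: An ideal on a set $S$ is a nonempty family of subsets of $S$ closed under subsets and finite unions (not required to be proper). Its dual filter is $\mathcal{F}(\mathcal{I})=\{S\setminus A: A\in\mathcal{I}\}$. For $M\subseteq S$, $\mathcal{K}|_M=\{A\cap M: A\in\mathcal{K}\}$ is the trace ideal on $M$. Let $(X,d)$ be a metric space. A function $f\colon S\to X$ is $\mathcal{I}$-divergent if there is $x\in X$ such that for every $r>0$, $\{k\in S: d(f(k),x)\le r\}\in\mathcal{I}$. It is $\mathcal{I}^{\mathcal{K}}$-divergent if there is $M\in\mathcal{F}(\mathcal{I})$ such that $f|_M\colon M\to X$ is $\mathcal{K}|_M$-divergent. *)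

theory Defs
  imports "HOL-Analysis.Abstract_Metric_Spaces"
begin

definition ideal_on :: "'a set \<Rightarrow> 'a set set \<Rightarrow> bool" where
  "ideal_on S \<I> \<longleftrightarrow> \<I> \<subseteq> Pow S \<and> \<I> \<noteq> {} \<and>
     (\<forall>A\<in>\<I>. \<forall>B. B \<subseteq> A \<longrightarrow> B \<in> \<I>) \<and>
     (\<forall>A\<in>\<I>. \<forall>B\<in>\<I>. A \<union> B \<in> \<I>)"

definition dual_filter :: "'a set \<Rightarrow> 'a set set \<Rightarrow> 'a set set" where
  "dual_filter S \<I> = {S - A | A. A \<in> \<I>}"

definition trace_ideal :: "'a set set \<Rightarrow> 'a set \<Rightarrow> 'a set set" where
  "trace_ideal \<K> M = {A \<inter> M | A. A \<in> \<K>}"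

text \<open>In the following two definitions \<open>f\<close> is regarded as a function from \<open>S\<close> to \<open>X\<close>;
  its values outside \<open>S\<close> are irrelevant. The typing \<open>f \<in> S \<rightarrow> X\<close> is not built in and
  is to be assumed wherever the notions are used.\<close>

definition I_divergent ::
  "'b set \<Rightarrow> ('b \<Rightarrow> 'b \<Rightarrow> real) \<Rightarrow> 'a set \<Rightarrow> 'a set set \<Rightarrow> ('a \<Rightarrow> 'b) \<Rightarrow> bool" where
  "I_divergent X d S \<I> f \<longleftrightarrow> (\<exists>x\<in>X. \<forall>r>0. {k \<in> S. d (f k) x \<le> r} \<in> \<I>)"

definition IK_divergent ::
  "'b set \<Rightarrow> ('b \<Rightarrow> 'b \<Rightarrow> real) \<Rightarrow> 'a set \<Rightarrow> 'a set set \<Rightarrow> 'a set set \<Rightarrow> ('a \<Rightarrow> 'b) \<Rightarrow> bool" where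
  "IK_divergent X d S \<I> \<K> f \<longleftrightarrow>
     (\<exists>M \<in> dual_filter S \<I>. I_divergent X d M (trace_ideal \<K> M) (restrict f M))"

end

theory Submission
  imports Defs
begin

text \<open>
  Divergence says that the function leaves every ball up to a set in the ideal, so it
  survives any enlargement of the ideal and any change of the function on a set in the ideal.

  For the first claim, let \<open>f\<close> diverge along \<open>\<K>\<close> on \<open>M = S - A\<close> with \<open>A \<in> \<I>\<close>. The part of
  the preimage of a ball inside \<open>M\<close> lies in \<open>\<K> \<subseteq> \<I>\<close>, and the rest is contained in \<open>A\<close>.

  For the second claim, take \<open>A \<in> \<K>\<close> and a \<open>\<K>\<close>-divergent function \<open>g\<close>, and collapse \<open>A\<close> to a
  single point of \<open>X\<close>. The modified function is still \<open>\<K>\<close>-divergent, hence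
  \<open>\<I>\<^sup>\<K>\<close>-divergent (with \<open>M = S\<close>), hence \<open>\<I>\<close>-divergent by hypothesis. But \<open>A\<close> is now
  contained in the preimage of a single ball about whatever centre witnesses the
  \<open>\<I>\<close>-divergence, so \<open>A \<in> \<I>\<close>.
\<close>

lemma ideal_on_subset: "ideal_on S \<I> \<Longrightarrow> A \<in> \<I> \<Longrightarrow> B \<subseteq> A \<Longrightarrow> B \<in> \<I>"
  unfolding ideal_on_def by blast

lemma ideal_on_Un: "ideal_on S \<I> \<Longrightarrow> A \<in> \<I> \<Longrightarrow> B \<in> \<I> \<Longrightarrow> A \<union> B \<in> \<I>"
  unfolding ideal_on_def by blast

lemma ideal_on_empty: "ideal_on S \<I> \<Longrightarrow> {} \<in> \<I>"
  unfolding ideal_on_def by blast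

lemma trace_ideal_subset: "ideal_on S \<K> \<Longrightarrow> trace_ideal \<K> M \<subseteq> \<K>"
  unfolding trace_ideal_def by (auto intro: ideal_on_subset)

lemma trace_ideal_whole:
  assumes "ideal_on S \<K>"
  shows "trace_ideal \<K> S = \<K>"
proof -
  have "A \<inter> S = A" if "A \<in> \<K>" for A
    using assms that by (auto simp: ideal_on_def)
  then show ?thesis by (force simp: trace_ideal_def)
qed

lemma whole_in_dual_filter: "ideal_on S \<I> \<Longrightarrow> S \<in> dual_filter S \<I>"
  unfolding dual_filter_def using ideal_on_empty by fastforce

lemma I_divergent_restrict:
  "I_divergent X d M \<I> (restrict f M) \<longleftrightarrow> I_divergent X d M \<I> f"
proof -
  have "{k \<in> M. d (restrict f M k) x \<le> r} = {k \<in> M. d (f k) x \<le> r}" for x r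
    by auto
  then show ?thesis by (simp add: I_divergent_def)
qed

text \<open>The set \<open>M = S\<close> witnesses this, since the trace of an ideal on the whole set is the
  ideal itself.\<close>

lemma I_divergent_imp_IK_divergent:
  assumes "ideal_on S \<I>" and "ideal_on S \<K>" and "I_divergent X d S \<K> f"
  shows "IK_divergent X d S \<I> \<K> f"
proof -
  have "I_divergent X d S (trace_ideal \<K> S) (restrict f S)"
    using assms by (simp add: trace_ideal_whole I_divergent_restrict)
  then show ?thesis
    using whole_in_dual_filter[OF assms(1)] by (auto simp: IK_divergent_def)
qed

text \<open>The same centre works for both functions: the preimages of a ball differ only inside
  \<open>A\<close>, and adding a set of the ideal does not leave the ideal.\<close>

lemma I_divergent_modify:
  assumes I: "ideal_on S \<I>" and A: "A \<in> \<I>" and g: "I_divergent X d S \<I> g"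
    and eq: "\<And>k. k \<in> S - A \<Longrightarrow> f k = g k"
  shows "I_divergent X d S \<I> f"
proof -
  obtain x where x: "x \<in> X" "\<And>r. r > 0 \<Longrightarrow> {k \<in> S. d (g k) x \<le> r} \<in> \<I>"
    using g by (auto simp: I_divergent_def)
  have "{k \<in> S. d (f k) x \<le> r} \<in> \<I>" if "r > 0" for r
  proof (rule ideal_on_subset[OF I])
    show "A \<union> {k \<in> S. d (g k) x \<le> r} \<in> \<I>"
      using ideal_on_Un[OF I A x(2)[OF that]] .
    show "{k \<in> S. d (f k) x \<le> r} \<subseteq> A \<union> {k \<in> S. d (g k) x \<le> r}"
      using eq by auto
  qed
  with x(1) show ?thesis by (auto simp: I_divergent_def)
qed

lemma IK_divergent_imp_I_divergent:
  assumes I: "ideal_on S \<I>" and K: "ideal_on S \<K>" and "\<K> \<subseteq> \<I>"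
    and f: "IK_divergent X d S \<I> \<K> f"
  shows "I_divergent X d S \<I> f"
proof -
  obtain A where A: "A \<in> \<I>"
    and div: "I_divergent X d (S - A) (trace_ideal \<K> (S - A)) (restrict f (S - A))"
    using f by (auto simp: IK_divergent_def dual_filter_def)
  have "I_divergent X d (S - A) (trace_ideal \<K> (S - A)) f"
    using div by (simp only: I_divergent_restrict)
  then obtain x where x: "x \<in> X"
    "\<And>r. r > 0 \<Longrightarrow> {k \<in> S - A. d (f k) x \<le> r} \<in> trace_ideal \<K> (S - A)"
    by (auto simp: I_divergent_def)
  have "{k \<in> S. d (f k) x \<le> r} \<in> \<I>" if "r > 0" for r
  proof (rule ideal_on_subset[OF I])
    have "{k \<in> S - A. d (f k) x \<le> r} \<in> \<I>"
      using x(2)[OF that] trace_ideal_subset[OF K] \<open>\<K> \<subseteq> \<I>\<close> by blast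
    then show "A \<union> {k \<in> S - A. d (f k) x \<le> r} \<in> \<I>"
      by (rule ideal_on_Un[OF I A])
  qed auto
  with x(1) show ?thesis by (auto simp: I_divergent_def)
qed

text \<open>A set on which an \<open>\<I>\<close>-divergent function is constant lies in the preimage of some ball
  about the centre of divergence, so it is small.\<close>

lemma I_divergent_const_on:
  assumes I: "ideal_on S \<I>" and f: "I_divergent X d S \<I> f"
    and "A \<subseteq> S" and const: "\<And>k. k \<in> A \<Longrightarrow> f k = a"
  shows "A \<in> \<I>"
proof -
  obtain y where y: "\<And>r. r > 0 \<Longrightarrow> {k \<in> S. d (f k) y \<le> r} \<in> \<I>"
    using f by (auto simp: I_divergent_def)
  \<comment> \<open>The maximum with 1 keeps the radius positive when \<open>a\<close> is the centre itself.\<close>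
  have "{k \<in> S. d (f k) y \<le> max 1 (d a y)} \<in> \<I>"
    by (rule y) simp
  then show ?thesis
    by (rule ideal_on_subset[OF I]) (use \<open>A \<subseteq> S\<close> const in auto)
qed

lemma subset_if_IK_divergent_imp_I_divergent:
  assumes I: "ideal_on S \<I>" and K: "ideal_on S \<K>"
    and g: "g \<in> S \<rightarrow> X" "I_divergent X d S \<K> g"
    and imp: "\<And>f. f \<in> S \<rightarrow> X \<Longrightarrow> IK_divergent X d S \<I> \<K> f \<Longrightarrow> I_divergent X d S \<I> f"
  shows "\<K> \<subseteq> \<I>"
proof
  fix A assume A: "A \<in> \<K>"
  obtain a where a: "a \<in> X"
    using g(2) by (auto simp: I_divergent_def)
  define f where "f k = (if k \<in> A then a else g k)" for k
  have "f \<in> S \<rightarrow> X"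
    using g(1) a by (auto simp: f_def)
  moreover have "IK_divergent X d S \<I> \<K> f"
    by (intro I_divergent_imp_IK_divergent[OF I K] I_divergent_modify[OF K A g(2)])
      (simp add: f_def)
  ultimately have "I_divergent X d S \<I> f"
    by (rule imp)
  moreover have "A \<subseteq> S"
    using K A by (auto simp: ideal_on_def)
  ultimately show "A \<in> \<I>"
    by (rule I_divergent_const_on[OF I]) (simp add: f_def)
qed

theorem theorem6p7:
  fixes X :: "'b set" and d :: "'b \<Rightarrow> 'b \<Rightarrow> real"
    and S :: "'a set" and \<I> \<K> :: "'a set set"
  assumes "Metric_space X d" and "ideal_on S \<I>" and "ideal_on S \<K>"
  shows "(\<K> \<subseteq> \<I> \<longrightarrow>
            (\<forall>f \<in> S \<rightarrow> X. IK_divergent X d S \<I> \<K> f \<longrightarrow> I_divergent X d S \<I> f)) \<and>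
         (\<not> Metric_space.mbounded X d X \<longrightarrow>
            (\<exists>g \<in> S \<rightarrow> X. I_divergent X d S \<K> g) \<longrightarrow>
            (\<forall>f \<in> S \<rightarrow> X. IK_divergent X d S \<I> \<K> f \<longrightarrow> I_divergent X d S \<I> f) \<longrightarrow>
            \<K> \<subseteq> \<I>)"
  using IK_divergent_imp_I_divergent[OF assms(2,3)]
    subset_if_IK_divergent_imp_I_divergent[OF assms(2,3)]
  by blast

end
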